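(* Let $n\in\{1,\dots,N\}$, $d\ge0$ and $h>0$. Then for all positive integers $m_1\le m_2$, $$Q_{n,1}(d,h;m_1,\tau)\ \ge\ Q_{n,1}(d,h;m_2,\tau).$$
   Context: Constants: $N\ge1$ is an integer (number of sub-tasks); $W>0$ (bandwidth); $\tau>0$ (channel coherence time). $p$ is a probability density on $(0,\infty)$, the common density of the i.i.d. channel gains. Energy to send $d\ge0$ nats in a fading block of duration $s>0$ with channel gain $h>0$: $e(d,h,s)=\dfrac{\left(e^{d/(Ws)}-1\right)s}{h}$. For an integer $M\ge1$ (number of fading blocks) and $t\in(0,\tau]$ (duration of the last block; the first $M-1$ blocks have duration $\tau$), the functions $Q_{n,m}(d,h;M,t)$ and $Q_{n,m}(d;M,t)$, for $m\in\{1,\dots,M\}$, $d\ge0$, $h>0$, are defined by backward recursion on $m$: $$Q_{n,M}(d,h;M,t)=e(d,h,t),$$ $$Q_{n,m}(d;M,t)=\int_0^\infty Q_{n,m}(d,x;M,t)\,p(x)\,dx\qquad (1\le m\le M),$$ $$Q_{n,m}(d,h;M,t)=\min_{0\le d'\le d}\Big(e(d',h,\tau)+Q_{n,m+1}(d-d';M,t)\Big)\qquad (1\le m\le M-1).$$ Values are taken in $[0,+\infty]$, and the minimum is read as an infimum if it is not attained. In the claim, the third argument ($m_1$ or $m_2$) is the total number $M$ of blocks and the last block has full duration $t=\tau$. *)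

theory Defs
  imports "HOL-Analysis.Analysis"
begin

definition prob_density_pos :: "(real \<Rightarrow> real) \<Rightarrow> bool" where
  "prob_density_pos p \<longleftrightarrow>
     set_borel_measurable lborel {0<..} p \<and> (\<forall>x>0. 0 \<le> p x) \<and>
     (\<integral>\<^sup>+x\<in>{0<..}. ennreal (p x) \<partial>lborel) = 1"

definition tx_energy :: "real \<Rightarrow> real \<Rightarrow> real \<Rightarrow> real \<Rightarrow> real" where
  "tx_energy W d h s = (exp (d / (W * s)) - 1) * s / h"

text \<open>
  With \<open>W\<close>, \<open>\<tau>\<close>, \<open>p\<close> fixed, \<open>Q W \<tau> p n M t m d h\<close> is $Q_{n,m}(d,h;M,t)$ and
  \<open>Q_avg W \<tau> p n M t m d\<close> is $Q_{n,m}(d;M,t)$. The index \<open>n\<close> is carried along only to match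
  the notation; the recursion does not depend on it. Only \<open>1 \<le> m \<le> M\<close> is meaningful: for
  \<open>m > M\<close> the (junk) value is that of the last block. The infimum over \<open>{0..d}\<close> is meant
  for \<open>d \<ge> 0\<close>, and \<open>ennreal\<close> truncates nothing when \<open>d \<ge> 0\<close> and \<open>W, h, s > 0\<close>.
\<close>

function Q :: "real \<Rightarrow> real \<Rightarrow> (real \<Rightarrow> real) \<Rightarrow> nat \<Rightarrow> nat \<Rightarrow> real \<Rightarrow> nat \<Rightarrow> real \<Rightarrow> real \<Rightarrow> ennreal"
  and Q_avg :: "real \<Rightarrow> real \<Rightarrow> (real \<Rightarrow> real) \<Rightarrow> nat \<Rightarrow> nat \<Rightarrow> real \<Rightarrow> nat \<Rightarrow> real \<Rightarrow> ennreal"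
where
  "Q W \<tau> p n M t m d h =
     (if m < M
      then (INF d'\<in>{0..d}. ennreal (tx_energy W d' h \<tau>) + Q_avg W \<tau> p n M t (Suc m) (d - d'))
      else ennreal (tx_energy W d h t))"
| "Q_avg W \<tau> p n M t m d =
     (\<integral>\<^sup>+x\<in>{0<..}. Q W \<tau> p n M t m d x * ennreal (p x) \<partial>lborel)"
  by pat_completeness auto
termination
  by (relation "Wellfounded.measure (case_sum
        (\<lambda>(W, \<tau>, p, n, M, t, m, d, h). 2 * (M - m))
        (\<lambda>(W, \<tau>, p, n, M, t, m, d). 2 * (M - m) + 1))") auto

declare Q.simps [simp del] Q_avg.simps [simp del]

end

theory Submission
  imports Defs
begin

text \<open>
  An extra block can be left empty: since sending nothing costs nothing, the recursion for
  \<open>M + 1\<close> blocks is dominated in block \<open>M\<close> by the one for \<open>M\<close> blocks, and the recursion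
  step is monotone, so this domination propagates backwards to every earlier block.
\<close>

lemma tx_energy_0 [simp]: "tx_energy W 0 h s = 0"
  by (simp add: tx_energy_def)

lemma Q_avg_last_0 [simp]: "Q_avg W \<tau> p n M t M 0 = 0"
  by (simp add: Q_avg.simps Q.simps)

lemma Q_avg_mono:
  assumes "\<And>x. x > 0 \<Longrightarrow> Q W \<tau> p n M t m d x \<le> Q W \<tau> p n M' t' m' d x"
  shows "Q_avg W \<tau> p n M t m d \<le> Q_avg W \<tau> p n M' t' m' d"
  unfolding Q_avg.simps
  by (intro nn_integral_mono) (auto simp: assms indicator_def intro!: mult_right_mono)

lemma Q_Suc_blocks_le:
  assumes "m \<le> M" and "d \<ge> 0"
  shows "Q W \<tau> p n (Suc M) \<tau> m d h \<le> Q W \<tau> p n M \<tau> m d h"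
  using assms
\<comment> \<open>Downward from \<open>m = M\<close>; \<open>d\<close> and \<open>h\<close> vary,
  since a step averages over the gain and passes on only \<open>d - d'\<close>.\<close>
proof (induction m arbitrary: d h rule: inc_induct)
  case base
  \<comment> \<open>Witness \<open>d' = d\<close>: block \<open>M\<close> carries everything, at
    equal cost because its duration is \<open>\<tau>\<close> on both sides; block
    \<open>Suc M\<close> gets 0 and adds nothing.\<close>
  then show ?case
    by (subst (1 2) Q.simps) (auto intro!: INF_lower2[of d])
next
  case (step m)
  have "Q_avg W \<tau> p n (Suc M) \<tau> (Suc m) (d - d') \<le> Q_avg W \<tau> p n M \<tau> (Suc m) (d - d')"
    if "d' \<in> {0..d}" for d'
    using that by (intro Q_avg_mono step.IH) auto
  then show ?case
    using step.hyps
    by (subst (1 2) Q.simps) (auto intro!: INF_superset_mono add_left_mono)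
qed

theorem lemma2:
  fixes N n m\<^sub>1 m\<^sub>2 :: nat and W \<tau> d h :: real and p :: "real \<Rightarrow> real"
  assumes "N \<ge> 1" and "W > 0" and "\<tau> > 0" and "prob_density_pos p"
    and "n \<in> {1..N}" and "d \<ge> 0" and "h > 0"
    and "1 \<le> m\<^sub>1" and "m\<^sub>1 \<le> m\<^sub>2"
  shows "Q W \<tau> p n m\<^sub>1 \<tau> 1 d h \<ge> Q W \<tau> p n m\<^sub>2 \<tau> 1 d h"
  using \<open>m\<^sub>1 \<le> m\<^sub>2\<close>
proof (induction m\<^sub>2 rule: dec_induct)
  case (step M)
  \<comment> \<open>The bound \<open>1 \<le> M\<close> it needs follows from
    \<open>1 \<le> m\<^sub>1\<close> and \<open>m\<^sub>1 \<le> M\<close>.\<close>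
  have "Q W \<tau> p n (Suc M) \<tau> 1 d h \<le> Q W \<tau> p n M \<tau> 1 d h"
    using step.hyps assms by (intro Q_Suc_blocks_le) auto
  then show ?case
    using step.IH by (rule order_trans)
qed simp

end
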